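(* Let $\mathcal{L}:c_1x_1+\dots+c_kx_k=0$ with $k\ge3$, $c_1,\dots,c_k\in\mathbb{Z}\setminus\{0\}$ and $c_1+\dots+c_k\ne0$. Then there exists $C=C(\mathcal{L})>0$ such that for every $\varepsilon\in(0,1)$, $$d(\mathcal{L},\varepsilon)\ge\varepsilon^{C}.$$
   Context: For a prime $p$, a set $A\subseteq\mathbb{F}_p$ is solution-free for $\mathcal{L}$ if there is no $k$-tuple of pairwise distinct elements $a_1,\dots,a_k\in A$ with $\sum_i c_ia_i=0$ in $\mathbb{F}_p$. The Cayley graph $\mathrm{Cay}_{\mathbb{F}_p}(A)$ is the digraph on $\mathbb{F}_p$ with an arc $\vec{uv}$ iff $v-u\in A$; $\alpha$ of a digraph is the independence number of its underlying undirected graph. $D(\mathcal{L},\varepsilon,p)$ is the maximum size of a solution-free set $A$ of $\mathcal{L}$ in $\mathbb{F}_p$ with $\alpha(\mathrm{Cay}_{\mathbb{F}_p}(A))\le\varepsilon p$, and $d(\mathcal{L},\varepsilon):=\limsup_{p\to\infty,\ p\text{ prime}} D(\mathcal{L},\varepsilon,p)/p$.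
   Formalization: As stated this fails as ε→1, since d(L,ε) ≤ 1/2 for all ε while ε^C→1; what is proved is that for every δ<1 there is C=C(L,δ)>0 with d(L,ε) ≥ ε^C for all ε in (0,δ]. *)

theory Defs
  imports
    "HOL-Number_Theory.Residues"
    "HOL-Library.Extended_Real"
    "HOL-Library.Liminf_Limsup"
    "Graph_Theory.Digraph_Component"
begin

text \<open>
  The field \<open>F\<^sub>p\<close> is represented by the carrier \<open>{0..p - 1}\<close> of
  \<^term>\<open>residue_ring (int p)\<close>, so that distinct carrier elements are distinct residue classes.
  The equation \<open>L\<close> is given by its length \<open>k\<close> and its coefficients \<open>c 1, \<dots>, c k\<close>.
\<close>

definition solution_free :: "nat \<Rightarrow> (nat \<Rightarrow> int) \<Rightarrow> nat \<Rightarrow> int set \<Rightarrow> bool" where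
  "solution_free k c p A \<longleftrightarrow>
     A \<subseteq> carrier (residue_ring (int p)) \<and>
     \<not> (\<exists>a. (\<forall>i\<in>{1..k}. a i \<in> A) \<and> inj_on a {1..k} \<and>
            [(\<Sum>i=1..k. c i * a i) = 0] (mod int p))"

definition cayley_digraph :: "nat \<Rightarrow> int set \<Rightarrow> int pair_pre_digraph" where
  "cayley_digraph p A =
     \<lparr> pverts = carrier (residue_ring (int p)),
       parcs = {(u, v). u \<in> carrier (residue_ring (int p)) \<and>
                        v \<in> carrier (residue_ring (int p)) \<and>
                        (v - u) mod int p \<in> A} \<rparr>"

text \<open>
  Independence refers to the underlying undirected graph, a simple graph: a loop (present at every
  vertex of the Cayley digraph when \<open>0 \<in> A\<close>) does not keep its vertex out of an independent set.
\<close>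

definition independent_set :: "('a, 'b) pre_digraph \<Rightarrow> 'a set \<Rightarrow> bool" where
  "independent_set G S \<longleftrightarrow>
     S \<subseteq> verts G \<and> (\<forall>u\<in>S. \<forall>v\<in>S. u \<noteq> v \<longrightarrow> (u, v) \<notin> parcs (mk_symmetric G))"

definition independence_number :: "('a, 'b) pre_digraph \<Rightarrow> nat" where
  "independence_number G = Max {card S | S. independent_set G S}"

text \<open>
  If no admissible set exists (for instance if \<open>\<epsilon> * p < 1\<close>), the supremum of the empty set of
  natural numbers gives \<open>max_solution_free k c \<epsilon> p = 0\<close>.
\<close>

definition max_solution_free :: "nat \<Rightarrow> (nat \<Rightarrow> int) \<Rightarrow> real \<Rightarrow> nat \<Rightarrow> nat" where
  "max_solution_free k c \<epsilon> p =
     Sup {card A | A. solution_free k c p A \<and>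
            real (independence_number (with_proj (cayley_digraph p A))) \<le> \<epsilon> * real p}"

definition solution_free_density :: "nat \<Rightarrow> (nat \<Rightarrow> int) \<Rightarrow> real \<Rightarrow> ereal" where
  "solution_free_density k c \<epsilon> =
     Limsup (inf at_top (principal {p. prime p}))
       (\<lambda>p. ereal (real (max_solution_free k c \<epsilon> p) / real p))"

text \<open>
  By pigeonhole, a set of more than \<open>p / 2 + O(k)\<close> residues contains a solution of every equation
  with \<open>k \<ge> 3\<close> and nonzero coefficients, so \<open>solution_free_density k c \<epsilon> \<le> 1 / 2\<close> for all \<open>\<epsilon>\<close>.
  Since \<open>\<epsilon> powr C\<close> tends to 1 as \<open>\<epsilon>\<close> tends to 1, no constant \<open>C\<close> gives
  \<open>\<epsilon> powr C \<le> solution_free_density k c \<epsilon>\<close> on all of \<open>(0, 1)\<close>.  The power lower bound is therefore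
  read as uniform on each \<open>(0, \<delta>]\<close> with \<open>\<delta> < 1\<close>.
\<close>

end

theory Submission
  imports Defs
begin

text \<open>
  Let \<open>A\<close> consist of the residues \<open>x\<close> for which all but fewer than \<open>d / k\<close> of the first \<open>d\<close> digits of
  \<open>x / p\<close> to base \<open>M\<close> are approximately \<open>l\<close>. Of \<open>k\<close> elements of \<open>A\<close>, some digit is about \<open>l\<close> in all of
  them, so a solution of the equation would make \<open>l * (\<Sum>i. c i) / M\<close> nearly an integer; since
  \<open>\<Sum>i. c i \<noteq> 0\<close>, suitable \<open>l\<close> and \<open>M\<close>, depending only on \<open>c\<close>, exclude this.

  For a set \<open>S\<close> of more than \<open>\<epsilon> * p\<close> residues, the digit words of its elements have density at least about
  \<open>\<epsilon>\<close> among all words of length \<open>d\<close>, and so do the words obtained by adding \<open>l\<close> to every digit modulo \<open>M\<close>.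
  By measure concentration in the Hamming cube, if \<open>d\<close> is a large multiple of \<open>ln (1 / \<epsilon>)\<close> then two such
  words differ in fewer than \<open>d / k\<close> places, which gives a difference of elements of \<open>S\<close> in \<open>A\<close>.
  Finally \<open>A\<close> contains all \<open>x\<close> whose first \<open>d\<close> digits equal \<open>l\<close>, so its density is about \<open>M\<close> to the
  power \<open>-d\<close>, a power of \<open>\<epsilon>\<close>.
\<close>


section \<open>Words over a finite alphabet and the Hamming distance\<close>

definition words :: "'a set \<Rightarrow> nat \<Rightarrow> 'a list set" where
  "words \<Sigma> d = {xs. set xs \<subseteq> \<Sigma> \<and> length xs = d}"

definition hamming :: "'a list \<Rightarrow> 'a list \<Rightarrow> nat" where
  "hamming xs ys = length (filter (\<lambda>(x, y). x \<noteq> y) (zip xs ys))"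

lemma hamming_Nil [simp]: "hamming [] [] = 0"
  by (simp add: hamming_def)

lemma hamming_Cons [simp]:
  "hamming (x # xs) (y # ys) = (if x = y then hamming xs ys else Suc (hamming xs ys))"
  by (simp add: hamming_def)

lemma hamming_conv_card:
  assumes "length xs = length ys"
  shows "hamming xs ys = card {i. i < length xs \<and> xs ! i \<noteq> ys ! i}"
proof -
  have "{i. i < length (zip xs ys) \<and> (\<lambda>(x, y). x \<noteq> y) (zip xs ys ! i)}
      = {i. i < length xs \<and> xs ! i \<noteq> ys ! i}"
    using assms by auto
  then show ?thesis
    by (simp only: hamming_def length_filter_conv_card)
qed

lemma words_0 [simp]: "words \<Sigma> 0 = {[]}"
  by (auto simp: words_def)

lemma Cons_in_words [simp]: "x # xs \<in> words \<Sigma> (Suc d) \<longleftrightarrow> x \<in> \<Sigma> \<and> xs \<in> words \<Sigma> d"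
  by (auto simp: words_def)

lemma finite_words [simp]: "finite \<Sigma> \<Longrightarrow> finite (words \<Sigma> d)"
  by (simp add: words_def finite_lists_length_eq)

lemma card_words: "finite \<Sigma> \<Longrightarrow> card (words \<Sigma> d) = card \<Sigma> ^ d"
  by (simp add: words_def card_lists_length_eq)

lemma sum_words_Suc:
  "(\<Sum>xs\<in>words \<Sigma> (Suc d). f xs) = (\<Sum>x\<in>\<Sigma>. \<Sum>xs\<in>words \<Sigma> d. f (x # xs))"
proof -
  have "words \<Sigma> (Suc d) = (\<lambda>(x, xs). x # xs) ` (\<Sigma> \<times> words \<Sigma> d)"
    by (auto simp: words_def length_Suc_conv)
  moreover have "inj_on (\<lambda>(x, xs). x # xs) (\<Sigma> \<times> words \<Sigma> d)"
    by (auto simp: inj_on_def)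
  ultimately have "(\<Sum>xs\<in>words \<Sigma> (Suc d). f xs) = (\<Sum>(x, xs)\<in>\<Sigma> \<times> words \<Sigma> d. f (x # xs))"
    by (simp add: sum.reindex case_prod_unfold)
  then show ?thesis
    by (simp add: sum.cartesian_product)
qed

lemma card_eq_sum_sections:
  assumes "finite \<Sigma>" "A \<subseteq> words \<Sigma> (Suc d)"
  shows "card A = (\<Sum>x\<in>\<Sigma>. card {ys. x # ys \<in> A})"
proof -
  have sub: "{ys. x # ys \<in> A} \<subseteq> words \<Sigma> d" for x
    using assms(2) by auto
  have "card A = (\<Sum>xs\<in>words \<Sigma> (Suc d). if xs \<in> A then 1 else 0)"
    using assms by (simp add: sum.inter_restrict [symmetric] Int_absorb1)
  also have "\<dots> = (\<Sum>x\<in>\<Sigma>. \<Sum>xs\<in>words \<Sigma> d. if xs \<in> {ys. x # ys \<in> A} then 1 else 0)"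
    by (simp add: sum_words_Suc)
  also have "\<dots> = (\<Sum>x\<in>\<Sigma>. card {ys. x # ys \<in> A})"
    using assms(1) sub by (intro sum.cong refl, subst sum.inter_restrict [symmetric])
      (simp_all add: Int_absorb1)
  finally show ?thesis .
qed

section \<open>Measure concentration for sets of words\<close>

text \<open>
  The factor \<open>(1 + a) * b - a * u\<close> is the chord of the convex function \<open>b\<^sup>2 / u\<close> between
  \<open>u = b / a\<close> and \<open>u = b\<close>.
\<close>

lemma min_le_chord:
  fixes F K a b u :: real
  assumes "F * u \<le> K" "F * b \<le> a * K" "0 \<le> u" "u \<le> b" "0 < b" "1 < a" "0 \<le> K"
  shows "F * b\<^sup>2 \<le> K * ((1 + a) * b - a * u)"
proof (cases "b \<le> a * u")
  case True
  then have u: "0 < u"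
    using assms by (smt (verit) mult_nonneg_nonpos)
  have "0 \<le> (b - u) * (a * u - b)"
    using True assms by simp
  then have *: "b\<^sup>2 \<le> u * ((1 + a) * b - a * u)"
    by (simp add: algebra_simps power2_eq_square)
  have "F * b\<^sup>2 * u = F * u * b\<^sup>2"
    by simp
  also have "\<dots> \<le> K * b\<^sup>2"
    using assms(1) by (simp add: mult_right_mono)
  also have "\<dots> \<le> K * (u * ((1 + a) * b - a * u))"
    using * assms(7) by (rule mult_left_mono)
  finally have "F * b\<^sup>2 * u \<le> K * ((1 + a) * b - a * u) * u"
    by (simp add: algebra_simps)
  then show ?thesis
    using u by simp
next
  case False
  have "F * b\<^sup>2 \<le> a * K * b"
    using mult_right_mono [OF assms(2), of b] assms(5) by (simp add: power2_eq_square algebra_simps)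
  also have "\<dots> \<le> K * ((1 + a) * b - a * u)"
    using False assms(7) mult_left_mono [of "a * u" b K] by (simp add: algebra_simps)
  finally show ?thesis .
qed

text \<open>
  Talagrand's induction for the Hamming distance to a set. The largest admissible \<open>f\<close> is
  \<open>a ^ dist(\<cdot>, A)\<close>, and after normalising the counting measure the constant is
  \<open>(1 + a)\<^sup>2 / (4 * a) = 1 + O((a - 1)\<^sup>2)\<close> per coordinate.
\<close>

lemma sum_times_card_le:
  fixes f :: "'a list \<Rightarrow> real" and a :: real
  assumes "finite \<Sigma>" "1 < a" "A \<subseteq> words \<Sigma> d"
    and "\<And>x y. x \<in> words \<Sigma> d \<Longrightarrow> y \<in> A \<Longrightarrow> f x \<le> a ^ hamming x y"
  shows "(\<Sum>x\<in>words \<Sigma> d. f x) * real (card A)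
       \<le> ((1 + a)\<^sup>2 / (4 * a) * (real (card \<Sigma>))\<^sup>2) ^ d"
  using assms(3,4)
proof (induction d arbitrary: f A)
  case 0
  then consider "A = {}" | "A = {[]}"
    by auto
  then show ?case
    using 0 by cases auto
next
  case (Suc d)
  define n where "n = real (card \<Sigma>)"
  define K where "K = ((1 + a)\<^sup>2 / (4 * a) * n\<^sup>2) ^ d"
  \<comment> \<open>\<open>B\<close> is \<open>A\<close> with first letters dropped. A word
    \<open>x # xs\<close> can be compared with the section of \<open>A\<close> at \<open>x\<close>,
    or, at the cost of at most one further mismatch and so a factor \<open>a\<close>, with any word
    of \<open>B\<close>.\<close>
  define B where "B = (\<Union>x\<in>\<Sigma>. {ys. x # ys \<in> A})"
  define u where "u x = real (card {ys. x # ys \<in> A})" for x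
  define b where "b = real (card B)"
  define F where "F x = (\<Sum>xs\<in>words \<Sigma> d. f (x # xs))" for x
  define U where "U = (\<Sum>x\<in>\<Sigma>. u x)"
  have K: "0 \<le> K"
    using assms(2) by (simp add: K_def)
  have sec: "{ys. x # ys \<in> A} \<subseteq> words \<Sigma> d" for x
    using Suc.prems(1) by auto
  have B: "B \<subseteq> words \<Sigma> d"
    using sec by (auto simp: B_def)
  then have finB: "finite B"
    using assms(1) finite_words finite_subset by blast
  have cardA: "real (card A) = U"
    using card_eq_sum_sections [OF assms(1) Suc.prems(1)] by (simp add: U_def u_def)
  show ?case
  proof (cases "B = {}")
    case True
    then have "U = 0"
      by (auto simp: U_def u_def B_def)
    then show ?thesis
      using assms(2) by (simp add: cardA)
  next
    case False
    then have b: "0 < b"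
      using finB by (simp add: b_def card_gt_0_iff)
    \<comment> \<open>The induction hypothesis enters twice: for the section at \<open>x\<close>,
      and for \<open>B\<close> with \<open>f / a\<close>. The chord makes the combined bound affine
      in \<open>u x\<close>, so that summing over \<open>x\<close> involves only the total
      \<open>U\<close>.\<close>
    have chord: "F x * b\<^sup>2 \<le> K * ((1 + a) * b - a * u x)" if x: "x \<in> \<Sigma>" for x
    proof (rule min_le_chord)
      show "F x * u x \<le> K"
        unfolding F_def u_def K_def n_def
        using Suc.prems(2) [of "x # _" "x # _"] x sec by (intro Suc.IH) force+
      have "(\<Sum>xs\<in>words \<Sigma> d. f (x # xs) / a) * b \<le> K"
        unfolding b_def K_def n_def
      proof (rule Suc.IH [OF B])
        fix xs ys
        assume xs: "xs \<in> words \<Sigma> d" and "ys \<in> B"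
        then obtain y where y: "y # ys \<in> A"
          by (auto simp: B_def)
        have "f (x # xs) \<le> a ^ hamming (x # xs) (y # ys)"
          using x xs y by (intro Suc.prems(2)) simp_all
        also have "\<dots> \<le> a ^ Suc (hamming xs ys)"
          using assms(2) by (intro power_increasing) auto
        finally show "f (x # xs) / a \<le> a ^ hamming xs ys"
          using assms(2) by (simp add: field_simps)
      qed
      then show "F x * b \<le> a * K"
        using assms(2) by (simp add: F_def sum_divide_distrib [symmetric] field_simps)
      show "u x \<le> b"
        using x finB unfolding u_def b_def by (auto simp: B_def intro!: card_mono)
    qed (use b assms(2) K in \<open>auto simp: u_def\<close>)
    have "(\<Sum>x\<in>\<Sigma>. F x) * b\<^sup>2 \<le> (\<Sum>x\<in>\<Sigma>. K * ((1 + a) * b - a * u x))"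
      unfolding sum_distrib_right by (intro sum_mono chord)
    also have "\<dots> = K * ((1 + a) * b * n - a * U)"
      by (simp add: sum_subtractf sum_distrib_left [symmetric] U_def n_def algebra_simps)
    finally have sumF: "(\<Sum>x\<in>\<Sigma>. F x) * b\<^sup>2 \<le> K * ((1 + a) * b * n - a * U)" .
    \<comment> \<open>This is AM-GM: it bounds a quadratic in \<open>U\<close> by its maximum, which
      no longer depends on the size of \<open>A\<close>.\<close>
    have "0 \<le> ((1 + a) * b * n - 2 * a * U)\<^sup>2"
      by simp
    then have "4 * a * (((1 + a) * b * n - a * U) * U) \<le> ((1 + a) * b * n)\<^sup>2"
      by (simp add: algebra_simps power2_eq_square)
    then have "((1 + a) * b * n - a * U) * U \<le> ((1 + a) * b * n)\<^sup>2 / (4 * a)"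
      using assms(2) by (simp add: pos_le_divide_eq mult.commute)
    then have amgm: "((1 + a) * b * n - a * U) * U \<le> (1 + a)\<^sup>2 / (4 * a) * n\<^sup>2 * b\<^sup>2"
      by (simp add: power_mult_distrib mult_ac)
    have U: "0 \<le> U"
      by (simp add: U_def u_def sum_nonneg)
    have "(\<Sum>x\<in>\<Sigma>. F x) * U * b\<^sup>2 \<le> K * ((1 + a) * b * n - a * U) * U"
      using mult_right_mono [OF sumF U] by (simp add: algebra_simps)
    also have "\<dots> \<le> K * ((1 + a)\<^sup>2 / (4 * a) * n\<^sup>2 * b\<^sup>2)"
      using mult_left_mono [OF amgm K] by (simp only: mult.assoc)
    also have "\<dots> = K * ((1 + a)\<^sup>2 / (4 * a) * n\<^sup>2) * b\<^sup>2"
      by simp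
    finally have "(\<Sum>x\<in>\<Sigma>. F x) * U \<le> K * ((1 + a)\<^sup>2 / (4 * a) * n\<^sup>2)"
      by (rule mult_right_le_imp_le) (use b in simp)
    then show ?thesis
      by (simp add: sum_words_Suc F_def cardA K_def n_def mult.commute)
  qed
qed

text \<open>Two sets at distance at least \<open>r\<close> cannot both be dense: take
  \<open>f\<close> to be \<open>a ^ r\<close> on \<open>B\<close> and 0 elsewhere.\<close>

corollary card_times_card_le:
  fixes a :: real
  assumes "finite \<Sigma>" "1 < a" "A \<subseteq> words \<Sigma> d" "B \<subseteq> words \<Sigma> d"
    and "\<And>x y. x \<in> B \<Longrightarrow> y \<in> A \<Longrightarrow> r \<le> hamming x y"
  shows "a ^ r * real (card B) * real (card A)
       \<le> ((1 + a)\<^sup>2 / (4 * a) * (real (card \<Sigma>))\<^sup>2) ^ d"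
proof -
  have "(\<Sum>x\<in>words \<Sigma> d. if x \<in> B then a ^ r else 0) = a ^ r * real (card B)"
    using assms(1,4) by (simp add: sum.inter_restrict [symmetric] Int_absorb1)
  moreover have "(\<Sum>x\<in>words \<Sigma> d. if x \<in> B then a ^ r else 0) * real (card A)
      \<le> ((1 + a)\<^sup>2 / (4 * a) * (real (card \<Sigma>))\<^sup>2) ^ d"
    using assms by (intro sum_times_card_le) (auto intro: power_increasing)
  ultimately show ?thesis
    by simp
qed

text \<open>With \<open>t = 1 / k\<close>, one coordinate costs at most \<open>1 + t^2 / 4\<close>,
  so \<open>k\<close> coordinates cost roughly \<open>1 + t / 4\<close>, less than the gain
  \<open>a = 1 + t\<close> from one unit of distance. Hence distance \<open>d / k\<close> in length
  \<open>d\<close> suffices for exponential decay.\<close>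

lemma talagrand_constant_power_less:
  fixes a :: real
  assumes "k \<ge> 1" "a = 1 + 1 / real k"
  shows "((1 + a)\<^sup>2 / (4 * a)) ^ k < a"
proof -
  define t where "t = 1 / real k"
  define x where "x = t\<^sup>2 / 4"
  have t: "0 < t" "t \<le> 1" and kt: "real k * t = 1" and a: "a = 1 + t" "0 < a"
    using assms by (simp_all add: t_def add_pos_pos)
  have t2: "t\<^sup>2 \<le> t"
    using t by (simp add: power2_eq_square mult_left_le)
  then have x: "0 < x" "x < 1"
    using t by (simp_all add: x_def)
  have "(1 + a)\<^sup>2 \<le> (1 + x) * (4 * a)"
    using t by (simp add: a(1) x_def power2_eq_square algebra_simps)
  then have C: "(1 + a)\<^sup>2 / (4 * a) \<le> 1 + x"
    using a(2) by (simp add: pos_divide_le_eq)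
  have "real k * x = t / 4"
    using kt by (simp add: x_def power2_eq_square)
  then have bern: "1 - t / 4 \<le> (1 - x) ^ k"
    using Bernoulli_inequality [of "- x" k] x by simp
  \<comment> \<open>\<open>(1 + x) ^ k\<close> is bounded above through Bernoulli's lower bound for
    \<open>(1 - x) ^ k\<close>, the product of the two being at most 1.\<close>
  have "((1 + a)\<^sup>2 / (4 * a)) ^ k * (1 - t / 4) \<le> (1 + x) ^ k * (1 - x) ^ k"
    using C bern x t a(2) by (intro mult_mono power_mono) simp_all
  also have "\<dots> = (1 - x\<^sup>2) ^ k"
    by (simp add: power_mult_distrib [symmetric] algebra_simps power2_eq_square)
  also have "\<dots> \<le> 1"
    using x by (intro power_le_one) (simp_all add: power_le_one)
  also have "1 < a * (1 - t / 4)"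
    using t t2 by (simp add: a(1) algebra_simps power2_eq_square)
  finally show ?thesis
    using t by (simp add: mult_less_cancel_right)
qed


section \<open>Base \<open>M\<close> digits and the scaled floor map\<close>

lemma int_div_less_iff:
  fixes y p n :: int
  assumes "0 < p"
  shows "y div p < n \<longleftrightarrow> y < n * p"
proof -
  have "y div p < n \<longleftrightarrow> real_of_int y / real_of_int p < real_of_int n"
    by (simp add: floor_divide_of_int_eq [where 'a = real, symmetric] floor_less_iff)
  also have "\<dots> \<longleftrightarrow> y < n * p"
    using assms by (simp add: pos_divide_less_eq flip: of_int_mult)
  finally show ?thesis .
qed

text \<open>The least significant digit comes first. Applied to \<open>x * M ^ d div p\<close>, list
  position \<open>i\<close> therefore holds digit number \<open>d - i\<close> of
  \<open>x / p\<close> after the point, which explains the index \<open>d - i\<close> below.\<close>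

fun digits :: "int \<Rightarrow> nat \<Rightarrow> int \<Rightarrow> int list" where
  "digits M 0 x = []"
| "digits M (Suc d) x = (x mod M) # digits M d (x div M)"

lemma digits_in_words: "0 < M \<Longrightarrow> digits M d x \<in> words {0..<M} d"
  by (induction d arbitrary: x) auto

lemma nth_digits: "0 < M \<Longrightarrow> i < d \<Longrightarrow> digits M d x ! i = x div M ^ i mod M"
proof (induction d arbitrary: x i)
  case (Suc d)
  then show ?case
    by (cases i) (auto simp: div_mult2_eq [symmetric] zdiv_zmult2_eq [symmetric])
qed simp

lemma inj_on_digits:
  assumes "0 < M"
  shows "inj_on (digits M d) {0..<M ^ d}"
proof -
  have "x = y" if "digits M d x = digits M d y" "0 \<le> x" "x < M ^ d" "0 \<le> y" "y < M ^ d" for x y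
    using that
  proof (induction d arbitrary: x y)
    case (Suc d)
    have "x div M = y div M"
      using Suc.prems assms
      by (intro Suc.IH) (auto simp: pos_imp_zdiv_nonneg_iff int_div_less_iff mult.commute)
    moreover have "x mod M = y mod M"
      using Suc.prems by simp
    ultimately show ?case
      by (metis div_mult_mod_eq)
  qed simp
  then show ?thesis
    by (auto simp: inj_on_def)
qed

text \<open>The fibre consists of the integers in a half-open real interval of length
  \<open>p / Q\<close>.\<close>

lemma floor_scale_fibre:
  fixes p Q :: int
  assumes "0 < p" "0 < Q"
  shows "finite {x. x * Q div p = n}"
    and "real (card {x. x * Q div p = n}) \<le> real_of_int p / real_of_int Q + 1"
    and "real_of_int p / real_of_int Q - 1 \<le> real (card {x. x * Q div p = n})"
proof -
  define l where "l = real_of_int (n * p) / real_of_int Q"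
  define u where "u = real_of_int ((n + 1) * p) / real_of_int Q"
  have ul: "u = l + real_of_int p / real_of_int Q" and lu: "l \<le> u"
    using assms by (simp_all add: u_def l_def algebra_simps add_divide_distrib divide_right_mono)
  have "x * Q div p = n \<longleftrightarrow> x \<in> {\<lceil>l\<rceil>..<\<lceil>u\<rceil>}" for x
  proof -
    have "x * Q div p = n \<longleftrightarrow> \<not> x * Q div p < n \<and> x * Q div p < n + 1"
      by auto
    also have "\<dots> \<longleftrightarrow> n * p \<le> x * Q \<and> x * Q < (n + 1) * p"
      by (simp only: int_div_less_iff [OF assms(1)] not_less)
    also have "\<dots> \<longleftrightarrow> l \<le> real_of_int x \<and> real_of_int x < u"
      unfolding l_def u_def using assms
      by (simp add: pos_divide_le_eq pos_less_divide_eq flip: of_int_mult)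
    also have "\<dots> \<longleftrightarrow> x \<in> {\<lceil>l\<rceil>..<\<lceil>u\<rceil>}"
      by (simp add: ceiling_le_iff less_ceiling_iff)
    finally show ?thesis .
  qed
  then have eq: "{x. x * Q div p = n} = {\<lceil>l\<rceil>..<\<lceil>u\<rceil>}"
    by blast
  have "\<lceil>l\<rceil> \<le> \<lceil>u\<rceil>"
    using lu by (rule ceiling_mono)
  then have "real (card {x. x * Q div p = n}) = real_of_int \<lceil>u\<rceil> - real_of_int \<lceil>l\<rceil>"
    by (simp add: eq)
  then show "real (card {x. x * Q div p = n}) \<le> real_of_int p / real_of_int Q + 1"
    and "real_of_int p / real_of_int Q - 1 \<le> real (card {x. x * Q div p = n})"
    using ul ceiling_correct [of l] ceiling_correct [of u] by linarith+
  show "finite {x. x * Q div p = n}"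
    by (simp add: eq)
qed

text \<open>Fibres have at most \<open>p / Q + 1\<close> elements, so density passes from a set of
  residues to its set of digit prefixes.\<close>

lemma card_le_card_image_floor_scale:
  fixes p Q :: int
  assumes "0 < p" "0 < Q" "finite S"
  shows "real (card S)
       \<le> real (card ((\<lambda>x. x * Q div p) ` S)) * (real_of_int p / real_of_int Q + 1)"
proof -
  let ?f = "\<lambda>x. x * Q div p"
  have "card S \<le> card (\<Union>n\<in>?f ` S. {x. ?f x = n})"
    using assms floor_scale_fibre(1) by (intro card_mono) auto
  also have "\<dots> \<le> (\<Sum>n\<in>?f ` S. card {x. ?f x = n})"
    using assms(3) by (intro card_UN_le) simp
  finally have "real (card S) \<le> (\<Sum>n\<in>?f ` S. real (card {x. ?f x = n}))"
    by (simp flip: of_nat_sum)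
  also have "\<dots> \<le> real (card (?f ` S)) * (real_of_int p / real_of_int Q + 1)"
    using floor_scale_fibre(2) [OF assms(1,2)] by (intro sum_bounded_above) simp
  finally show ?thesis .
qed

section \<open>Residues with mostly prescribed digits, and solution-freeness\<close>

text \<open>
  \<open>near p M l j x\<close> says that \<open>M ^ (j - 1) * x / p\<close> is within \<open>1 / M\<close> of \<open>l / M\<close> modulo 1, that is,
  that the \<open>j\<close>-th digit of \<open>x / p\<close> to base \<open>M\<close> is about \<open>l\<close>.
\<close>

definition near :: "int \<Rightarrow> int \<Rightarrow> int \<Rightarrow> nat \<Rightarrow> int \<Rightarrow> bool" where
  "near p M l j x \<longleftrightarrow> (\<exists>n. \<bar>x * M ^ j - (l + n * M) * p\<bar> \<le> p)"

text \<open>The strict inequality is what prevents \<open>k\<close> exceptional sets from covering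
  all \<open>d\<close> positions. The index \<open>i\<close> is a position in the digit
  list.\<close>

definition mostly_near :: "int \<Rightarrow> int \<Rightarrow> int \<Rightarrow> nat \<Rightarrow> nat \<Rightarrow> int set" where
  "mostly_near p M l k d =
     {x \<in> {0..<p}. k * card {i. i < d \<and> \<not> near p M l (d - i) x} < d}"

text \<open>For \<open>j\<close> at least 1, changing \<open>x\<close> by a multiple of
  \<open>p\<close> changes \<open>x * M ^ j\<close> by a multiple of \<open>M * p\<close>, which
  \<open>n\<close> absorbs.\<close>

lemma near_mod:
  assumes "near p M l j x" "1 \<le> j"
  shows "near p M l j (x mod p)"
proof -
  obtain n where n: "\<bar>x * M ^ j - (l + n * M) * p\<bar> \<le> p"
    using assms(1) by (auto simp: near_def)
  obtain i where j: "j = Suc i"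
    using assms(2) by (cases j) auto
  have "(x mod p) * M ^ j - (l + (n - (x div p) * M ^ i) * M) * p = x * M ^ j - (l + n * M) * p"
    by (simp add: j minus_div_mult_eq_mod [symmetric] algebra_simps)
  then show ?thesis
    using n unfolding near_def by metis
qed

text \<open>Multiplying the equation by \<open>M ^ j / p\<close> puts \<open>s * l\<close>, with
  \<open>s\<close> the coefficient sum, within \<open>C = l - 1\<close> of a multiple of
  \<open>M\<close>. But \<open>M\<close> is \<open>(\<bar>s\<bar> + 1) * l\<close>, so the
  difference is a multiple of \<open>l\<close>, and it is nonzero because
  \<open>\<bar>s\<bar> + 1\<close> cannot divide \<open>s \<noteq> 0\<close>.\<close>

lemma near_combination_False:
  fixes a c :: "'a \<Rightarrow> int"
  assumes "0 < p" "1 \<le> j" "\<And>i. i \<in> I \<Longrightarrow> near p M l j (a i)"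
    and "[(\<Sum>i\<in>I. c i * a i) = 0] (mod p)"
    and "l = (\<Sum>i\<in>I. \<bar>c i\<bar>) + 1" "M = (\<bar>\<Sum>i\<in>I. c i\<bar> + 1) * l" "(\<Sum>i\<in>I. c i) \<noteq> 0"
  shows False
proof -
  define C where "C = (\<Sum>i\<in>I. \<bar>c i\<bar>)"
  define s where "s = (\<Sum>i\<in>I. c i)"
  obtain n where n: "\<And>i. i \<in> I \<Longrightarrow> \<bar>a i * M ^ j - (l + n i * M) * p\<bar> \<le> p"
    using assms(3) unfolding near_def by metis
  obtain i0 where j: "j = Suc i0"
    using assms(2) by (cases j) auto
  obtain z where z: "(\<Sum>i\<in>I. c i * a i) = p * z"
    using assms(4) by (auto simp: cong_0_iff)
  define w where "w = z * M ^ i0 - (\<Sum>i\<in>I. c i * n i)"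
  have "(\<Sum>i\<in>I. c i * (a i * M ^ j - (l + n i * M) * p))
      = (\<Sum>i\<in>I. M ^ j * (c i * a i) - l * p * c i - M * p * (c i * n i))"
    by (simp add: algebra_simps)
  also have "\<dots> = M ^ j * (\<Sum>i\<in>I. c i * a i) - l * p * s - M * p * (\<Sum>i\<in>I. c i * n i)"
    by (simp only: s_def sum_subtractf sum_distrib_left)
  also have "\<dots> = (w * M - s * l) * p"
    unfolding z by (simp add: w_def j algebra_simps)
  finally have "\<bar>w * M - s * l\<bar> * p = \<bar>\<Sum>i\<in>I. c i * (a i * M ^ j - (l + n i * M) * p)\<bar>"
    using assms(1) by (simp add: abs_mult)
  also have "\<dots> \<le> (\<Sum>i\<in>I. \<bar>c i * (a i * M ^ j - (l + n i * M) * p)\<bar>)"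
    by (rule sum_abs)
  also have "\<dots> \<le> (\<Sum>i\<in>I. \<bar>c i\<bar> * p)"
    using n by (intro sum_mono) (simp add: abs_mult mult_left_mono)
  also have "\<dots> = C * p"
    by (simp add: C_def sum_distrib_right)
  finally have le: "\<bar>w * M - s * l\<bar> \<le> C"
    using assms(1) by simp
  have l: "l = C + 1" and M: "M = (\<bar>s\<bar> + 1) * l" and C: "0 \<le> C" and s: "s \<noteq> 0"
    using assms by (simp_all add: C_def s_def sum_nonneg)
  have "w * M - s * l = (w * (\<bar>s\<bar> + 1) - s) * l"
    by (simp add: M algebra_simps)
  moreover have "w * (\<bar>s\<bar> + 1) - s \<noteq> 0"
  proof
    assume "w * (\<bar>s\<bar> + 1) - s = 0"
    then have "\<bar>s\<bar> + 1 dvd s"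
      by (metis dvd_triv_right eq_iff_diff_eq_0)
    then show False
      using s dvd_imp_le_int [of s "\<bar>s\<bar> + 1"] by simp
  qed
  ultimately have "l \<le> \<bar>w * M - s * l\<bar>"
    using l C by (simp add: abs_mult)
  then show False
    using le l by simp
qed

text \<open>Union bound: \<open>k\<close> elements have fewer than \<open>d\<close> exceptional
  positions in total, so at some position all of them are near, which
  \<open>near_combination_False\<close> excludes.\<close>

lemma solution_free_mostly_near:
  assumes "0 < p" "(\<Sum>i=1..k. c i) \<noteq> 0"
    and "l = (\<Sum>i=1..k. \<bar>c i\<bar>) + 1" "M = (\<bar>\<Sum>i=1..k. c i\<bar> + 1) * l"
  shows "solution_free k c p (mostly_near (int p) M l k d)"
  unfolding solution_free_def
proof (intro conjI notI)
  show "mostly_near (int p) M l k d \<subseteq> carrier (residue_ring (int p))"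
    by (auto simp: mostly_near_def residue_ring_def)
next
  assume "\<exists>a. (\<forall>i\<in>{1..k}. a i \<in> mostly_near (int p) M l k d) \<and> inj_on a {1..k} \<and>
              [(\<Sum>i=1..k. c i * a i) = 0] (mod int p)"
  then obtain a where a: "\<And>i. i \<in> {1..k} \<Longrightarrow> a i \<in> mostly_near (int p) M l k d"
    and sol: "[(\<Sum>i=1..k. c i * a i) = 0] (mod int p)"
    by blast
  define bad where "bad i = {j. j < d \<and> \<not> near (int p) M l (d - j) (a i)}" for i
  have k: "0 < k"
    using assms(2) by (cases k) auto
  have "card (\<Union>i\<in>{1..k}. bad i) \<le> (\<Sum>i=1..k. card (bad i))"
    by (intro card_UN_le) simp
  also have "\<dots> < d"
  proof -
    have "k * (\<Sum>i=1..k. card (bad i)) = (\<Sum>i=1..k. k * card (bad i))"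
      by (rule sum_distrib_left)
    also have "\<dots> < (\<Sum>i=1..k. d)"
      using a k by (intro sum_strict_mono) (auto simp: mostly_near_def bad_def)
    finally show ?thesis
      by simp
  qed
  finally have "\<not> {..<d} \<subseteq> (\<Union>i\<in>{1..k}. bad i)"
    using card_mono [of "\<Union>i\<in>{1..k}. bad i" "{..<d}"] by (auto simp: bad_def)
  then obtain j where j: "j < d" "\<And>i. i \<in> {1..k} \<Longrightarrow> near (int p) M l (d - j) (a i)"
    unfolding bad_def by blast
  show False
    using assms j by (intro near_combination_False [OF _ _ j(2) sol]) auto
qed

section \<open>Size of the set, and its appearance among differences\<close>

lemma digits_surj:
  assumes "0 < M"
  shows "digits M d ` {0..<M ^ d} = words {0..<M} d"
proof (rule card_subset_eq)
  show "card (digits M d ` {0..<M ^ d}) = card (words {0..<M} d)"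
    using assms by (simp add: card_image inj_on_digits card_words nat_power_eq)
qed (use assms digits_in_words in auto)

lemma floor_scale_div_power:
  fixes x p M :: int
  assumes "0 < M" "i \<le> d"
  shows "x * M ^ d div p div M ^ i = x * M ^ (d - i) div p"
proof -
  have "x * M ^ d div p div M ^ i = x * M ^ d div (p * M ^ i)"
    using assms(1) by (simp add: zdiv_zmult2_eq)
  also have "\<dots> = x * M ^ (d - i) * M ^ i div (p * M ^ i)"
    using assms(2) by (simp add: mult.assoc flip: power_add)
  also have "\<dots> = x * M ^ (d - i) div p"
    using assms(1) by simp
  finally show ?thesis .
qed

text \<open>Subtraction leaves only the difference of two remainders modulo \<open>p\<close>, so no
  carries need tracking. This is why \<open>near\<close> tolerates an error of
  \<open>p\<close>.\<close>

lemma near_diff: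
  assumes "0 < p" "(y * M ^ j div p) mod M = (x * M ^ j div p + l) mod M"
  shows "near p M l j (y - x)"
proof -
  define X Y where "X = x * M ^ j div p" and "Y = y * M ^ j div p"
  have "[Y = X + l] (mod M)"
    using assms(2) by (simp add: cong_def X_def Y_def)
  then obtain n where n: "Y = X + l + n * M"
    by (metis cong_iff_lin cong_sym mult.commute)
  have "x * M ^ j = X * p + x * M ^ j mod p" "y * M ^ j = Y * p + y * M ^ j mod p"
    by (simp_all add: X_def Y_def)
  then have "(y - x) * M ^ j - (l + n * M) * p = y * M ^ j mod p - x * M ^ j mod p"
    by (simp add: n algebra_simps)
  moreover have "\<bar>y * M ^ j mod p - x * M ^ j mod p\<bar> \<le> p"
    using assms(1) pos_mod_sign [of p "y * M ^ j"] pos_mod_bound [of p "y * M ^ j"]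
      pos_mod_sign [of p "x * M ^ j"] pos_mod_bound [of p "x * M ^ j"] by linarith
  ultimately show ?thesis
    unfolding near_def by metis
qed

lemma card_mostly_near:
  assumes "0 < p" "0 \<le> l" "l < M" "0 < d"
  shows "real_of_int p / real_of_int M ^ d - 1 \<le> real (card (mostly_near p M l k d))"
proof -
  have M: "0 < M"
    using assms by simp
  have "replicate d l \<in> words {0..<M} d"
    using assms by (auto simp: words_def)
  then obtain R where R: "0 \<le> R" "R < M ^ d" and digits_R: "digits M d R = replicate d l"
    unfolding digits_surj [OF M, symmetric] by auto
  have "x \<in> mostly_near p M l k d" if x: "x * M ^ d div p = R" for x
  proof -
    \<comment> \<open>An exact digit \<open>l\<close> is a digit of 0 plus \<open>l\<close>, so
      \<open>near_diff\<close> applies to \<open>x - 0\<close>.\<close>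
    have near: "near p M l (d - i) (x - 0)" if "i < d" for i
      using that assms M nth_digits [of M i d R] digits_R floor_scale_div_power [of M i d x p] x
      by (intro near_diff) auto
    have "0 \<le> x * M ^ d"
      using R(1) assms(1) by (simp add: x [symmetric] pos_imp_zdiv_nonneg_iff)
    then have x0: "0 \<le> x"
      using zero_less_power [OF M, of d] by (auto simp: zero_le_mult_iff)
    have "x * M ^ d < M ^ d * p"
      using R(2) assms(1) by (simp add: x [symmetric] int_div_less_iff)
    then have "x < p"
      using M by (simp add: mult.commute)
    moreover have bad: "{i. i < d \<and> \<not> near p M l (d - i) x} = {}"
      using near by auto
    ultimately show ?thesis
      using x0 assms(4) unfolding mostly_near_def mem_Collect_eq bad by simp
  qed
  then have "{x. x * M ^ d div p = R} \<subseteq> mostly_near p M l k d"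
    by blast
  then have "card {x. x * M ^ d div p = R} \<le> card (mostly_near p M l k d)"
    by (rule card_mono [rotated])
      (rule finite_subset [of _ "{0..<p}"], auto simp: mostly_near_def)
  then show ?thesis
    using floor_scale_fibre(3) [of p "M ^ d" R] assms M by simp
qed

text \<open>If every shifted word of \<open>S\<close> were at distance at least \<open>m\<close>
  from every word of \<open>S\<close>, concentration and \<open>small\<close> would bound their
  common number by \<open>e * M ^ d\<close>, against \<open>large\<close>. Agreement with a shifted
  digit makes that digit of \<open>v - u\<close> near \<open>l\<close>, and fewer than
  \<open>m = d / k\<close> positions disagree.\<close>

lemma mostly_near_difference:
  fixes a e :: real
  assumes "0 < p" "0 < l" "l < M" "0 < k" "0 < m" "1 < a" "0 < e"
    and "S \<subseteq> {0..<p}"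
    and large: "e * real_of_int M ^ (k * m) < real (card ((\<lambda>x. x * M ^ (k * m) div p) ` S))"
    and small: "(((1 + a)\<^sup>2 / (4 * a)) ^ k) ^ m \<le> e\<^sup>2 * a ^ m"
  obtains u v where "u \<in> S" "v \<in> S" "u \<noteq> v" "(v - u) mod p \<in> mostly_near p M l k (k * m)"
proof -
  define d where "d = k * m"
  define dig where "dig x = digits M d (x * M ^ d div p)" for x
  define shift where "shift = map (\<lambda>t. (t + l) mod M)"
  have M: "0 < M"
    using assms by simp
  have dig: "dig x \<in> words {0..<M} d" for x
    unfolding dig_def using M by (rule digits_in_words)
  have len: "length (dig x) = d" for x
    using dig by (simp add: words_def)
  have nth_dig: "dig x ! i = (x * M ^ (d - i) div p) mod M" if "i < d" for x i
    using that M by (simp add: dig_def nth_digits floor_scale_div_power)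
  have shift: "shift ` (dig ` S) \<subseteq> words {0..<M} d"
    using dig M by (auto simp: shift_def words_def)
  have inj_shift: "inj_on shift (dig ` S)"
  proof -
    have "inj_on (\<lambda>t. (t + l) mod M) {0..<M}"
    proof (rule inj_onI)
      fix s t assume "s \<in> {0..<M}" "t \<in> {0..<M}" "(s + l) mod M = (t + l) mod M"
      then show "s = t"
        by (metis cong_add_rcancel cong_def atLeastLessThan_iff mod_pos_pos_trivial)
    qed
    then have "inj_on shift (words {0..<M} d)"
      unfolding shift_def by (intro inj_on_mapI) (auto simp: words_def intro: inj_on_subset)
    then show ?thesis
      using dig by (auto intro: inj_on_subset)
  qed
  have card_dig: "card (dig ` S) = card ((\<lambda>x. x * M ^ d div p) ` S)"
  proof -
    have "x * M ^ d div p \<in> {0..<M ^ d}" if "x \<in> S" for x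
      using that assms(1,8) M
      by (auto simp: pos_imp_zdiv_nonneg_iff int_div_less_iff mult.commute)
    then have "inj_on (digits M d) ((\<lambda>x. x * M ^ d div p) ` S)"
      using inj_on_digits [OF M] by (blast intro: inj_on_subset)
    moreover have "dig ` S = digits M d ` (\<lambda>x. x * M ^ d div p) ` S"
      by (simp add: dig_def image_image)
    ultimately show ?thesis
      by (simp add: card_image)
  qed
  have "\<exists>u\<in>S. \<exists>v\<in>S. hamming (shift (dig u)) (dig v) < m"
  proof (rule ccontr)
    assume "\<not> ?thesis"
    then have "a ^ m * real (card (shift ` dig ` S)) * real (card (dig ` S))
        \<le> ((1 + a)\<^sup>2 / (4 * a) * (real (card {0..<M}))\<^sup>2) ^ d"
      using assms(6) dig shift by (intro card_times_card_le) (auto simp: not_less)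
    also have "\<dots> = ((1 + a)\<^sup>2 / (4 * a)) ^ d * (real_of_int M ^ d)\<^sup>2"
      using M by (simp only: power_mult_distrib power_even_eq [symmetric] card_atLeastLessThan_int)
        (simp add: power_mult [symmetric] mult.commute)
    also have "\<dots> = (((1 + a)\<^sup>2 / (4 * a)) ^ k) ^ m * (real_of_int M ^ d)\<^sup>2"
      by (simp only: d_def power_mult)
    also have "\<dots> \<le> e\<^sup>2 * a ^ m * (real_of_int M ^ d)\<^sup>2"
      using small by (rule mult_right_mono) simp
    also have "\<dots> = a ^ m * (e * real_of_int M ^ d)\<^sup>2"
      by (simp add: power_mult_distrib)
    finally have "(real (card (dig ` S)))\<^sup>2 \<le> (e * real_of_int M ^ d)\<^sup>2"
      using assms(6) card_image [OF inj_shift] by (simp add: power2_eq_square mult.assoc)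
    moreover have "0 \<le> e * real_of_int M ^ d"
      using assms(7) M by simp
    ultimately have "real (card (dig ` S)) \<le> e * real_of_int M ^ d"
      by (rule power2_le_imp_le)
    then show False
      using large card_dig by (simp add: d_def)
  qed
  then obtain u v where uv: "u \<in> S" "v \<in> S" and "hamming (shift (dig u)) (dig v) < m"
    by blast
  then have ham: "card {i. i < d \<and> shift (dig u) ! i \<noteq> dig v ! i} < m"
    by (simp add: hamming_conv_card len shift_def)
  \<comment> \<open>As \<open>0 < l < M\<close>, the shift changes every digit, so a word is at
    distance \<open>d\<close>, at least \<open>m\<close>, from its own shift.\<close>
  have "u \<noteq> v"
  proof
    assume "u = v"
    have "shift (dig u) ! i \<noteq> dig v ! i" if i: "i < d" for i
    proof
      assume "shift (dig u) ! i = dig v ! i"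
      then have "[dig v ! i + l = dig v ! i + 0] (mod M)"
        using i \<open>u = v\<close> by (simp add: shift_def len cong_def nth_dig)
      then have "[l = 0] (mod M)"
        by (simp only: cong_add_lcancel)
      then show False
        using assms(2,3) by (simp add: cong_0_iff zdvd_not_zless)
    qed
    then have "{i. i < d \<and> shift (dig u) ! i \<noteq> dig v ! i} = {..<d}"
      by auto
    then show False
      using ham assms(4) by (simp add: d_def)
  qed
  moreover have "(v - u) mod p \<in> mostly_near p M l k d"
  proof -
    have "near p M l (d - i) ((v - u) mod p)"
      if "i < d" "shift (dig u) ! i = dig v ! i" for i
      using that assms(1) by (intro near_mod near_diff) (auto simp: shift_def len nth_dig mod_simps)
    then have "{i. i < d \<and> \<not> near p M l (d - i) ((v - u) mod p)}
        \<subseteq> {i. i < d \<and> shift (dig u) ! i \<noteq> dig v ! i}"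
      by blast
    then have "card {i. i < d \<and> \<not> near p M l (d - i) ((v - u) mod p)}
        \<le> card {i. i < d \<and> shift (dig u) ! i \<noteq> dig v ! i}"
      by (rule card_mono [rotated]) simp
    also note ham
    finally show ?thesis
      using assms(1,4) by (simp add: mostly_near_def d_def)
  qed
  ultimately show ?thesis
    using that uv by (simp add: d_def)
qed

section \<open>From the construction to independence number and upper density\<close>

lemma independence_number_leI:
  assumes "finite (verts G)" "0 \<le> b"
    and "\<And>S. independent_set G S \<Longrightarrow> real (card S) \<le> b"
  shows "real (independence_number G) \<le> b"
proof -
  have "finite {card S | S. independent_set G S}"
    by (rule finite_subset [of _ "card ` Pow (verts G)"])
      (use assms(1) in \<open>auto simp: independent_set_def\<close>)
  moreover have "independent_set G {}"
    by (simp add: independent_set_def)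
  ultimately have "independence_number G \<in> {card S | S. independent_set G S}"
    unfolding independence_number_def by (intro Max_in) auto
  then show ?thesis
    using assms(3) by auto
qed

lemma independence_number_mostly_near:
  fixes a \<epsilon> :: real
  assumes "0 < p" "0 < l" "l < M" "0 < k" "0 < m" "1 < a" "0 < \<epsilon>"
    and "M ^ (k * m) \<le> int p"
    and "(((1 + a)\<^sup>2 / (4 * a)) ^ k) ^ m \<le> (\<epsilon> / 2)\<^sup>2 * a ^ m"
  shows "real (independence_number
           (with_proj (cayley_digraph p (mostly_near (int p) M l k (k * m))))) \<le> \<epsilon> * real p"
proof (rule independence_number_leI)
  let ?A = "mostly_near (int p) M l k (k * m)"
  let ?G = "with_proj (cayley_digraph p ?A)"
  have carrier: "carrier (residue_ring (int p)) = {0..<int p}"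
    by (auto simp: residue_ring_def)
  show "finite (verts ?G)"
    by (simp add: cayley_digraph_def carrier)
  show "0 \<le> \<epsilon> * real p"
    using assms(7) by simp
  fix S
  assume S: "independent_set ?G S"
  then have sub: "S \<subseteq> {0..<int p}"
    by (simp add: independent_set_def cayley_digraph_def carrier)
  then have fin: "finite S"
    by (rule finite_subset) simp
  define Q where "Q = M ^ (k * m)"
  have Q: "0 < Q" "Q \<le> int p"
    using assms by (auto simp: Q_def)
  show "real (card S) \<le> \<epsilon> * real p"
  proof (rule ccontr)
    assume "\<not> real (card S) \<le> \<epsilon> * real p"
    then have "\<epsilon> * real p < real (card ((\<lambda>x. x * Q div int p) ` S))
        * (real p / real_of_int Q + 1)"
      using card_le_card_image_floor_scale [of "int p" Q S] assms(1) Q fin by simp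
    \<comment> \<open>Since \<open>Q \<le> p\<close>, rounding at most doubles the fibre size; hence
      the density \<open>\<epsilon> / 2\<close> for words.\<close>
    also have "\<dots> \<le> real (card ((\<lambda>x. x * Q div int p) ` S)) * (2 * real p / real_of_int Q)"
      using Q by (intro mult_left_mono) (simp_all add: field_simps)
    finally have "\<epsilon> / 2 * real_of_int Q < real (card ((\<lambda>x. x * Q div int p) ` S))"
      using assms(1) Q(1) by (simp add: field_simps)
    then obtain u v where uv: "u \<in> S" "v \<in> S" "u \<noteq> v" "(v - u) mod int p \<in> ?A"
      using mostly_near_difference [of "int p" l M k m a "\<epsilon> / 2" S] assms sub by (auto simp: Q_def)
    then have "(u, v) \<in> parcs (cayley_digraph p ?A)"
      using sub by (auto simp: cayley_digraph_def carrier)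
    then have "(u, v) \<in> parcs (mk_symmetric ?G)"
      by (force simp: parcs_mk_symmetric)
    then show False
      using S uv by (auto simp: independent_set_def)
  qed
qed

lemma max_solution_free_ge:
  assumes "solution_free k c p A"
    and "real (independence_number (with_proj (cayley_digraph p A))) \<le> \<epsilon> * real p"
  shows "card A \<le> max_solution_free k c \<epsilon> p"
  unfolding max_solution_free_def
proof (rule cSup_upper)
  have "card B \<le> p" if "solution_free k c p B" for B
    using card_mono [of "{0..int p - 1}" B] that
    by (auto simp: solution_free_def residue_ring_def)
  then show "bdd_above {card A | A. solution_free k c p A \<and>
      real (independence_number (with_proj (cayley_digraph p A))) \<le> \<epsilon> * real p}"
    by (intro bdd_aboveI [of _ p]) auto
qed (use assms in auto)

lemma solution_free_density_ge:
  assumes "\<And>p. N \<le> p \<Longrightarrow> b * real p \<le> real (max_solution_free k c \<epsilon> p)"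
  shows "ereal b \<le> solution_free_density k c \<epsilon>"
  unfolding solution_free_density_def
proof (rule le_Limsup)
  \<comment> \<open>Over the trivial filter \<open>Limsup\<close> would be minus infinity; the
    infinitude of primes rules this out.\<close>
  show "inf at_top (principal {p::nat. prime p}) \<noteq> bot"
  proof
    assume "inf at_top (principal {p::nat. prime p}) = bot"
    then have "eventually (\<lambda>p::nat. \<not> prime p) at_top"
      by (simp add: trivial_limit_def eventually_inf_principal)
    then obtain n where "\<And>p::nat. n \<le> p \<Longrightarrow> \<not> prime p"
      by (auto simp: eventually_at_top_linorder)
    then show False
      using bigger_prime [of n] by (meson less_imp_le)
  qed
  have "b \<le> real (max_solution_free k c \<epsilon> p) / real p" if "N \<le> p" "prime p" for p
    using assms [OF that(1)] prime_gt_0_nat [OF that(2)] by (simp add: pos_le_divide_eq)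
  then show "\<forall>\<^sub>F p in inf at_top (principal {p. prime p}).
      ereal b \<le> ereal (real (max_solution_free k c \<epsilon> p) / real p)"
    unfolding eventually_inf_principal eventually_at_top_linorder by auto
qed

section \<open>Choice of the exponent and assembly of the bound\<close>

text \<open>With \<open>t = - ln \<epsilon>\<close>, the first bound needs \<open>m\<close> of order
  \<open>t\<close>, and then \<open>Q ^ m\<close> is at most exponential in \<open>t\<close>. Since
  \<open>\<epsilon> \<le> \<delta> < 1\<close> gives \<open>t \<ge> L > 0\<close>, additive
  constants are absorbed into multiples of \<open>t / L\<close>.\<close>

lemma exists_power_exponent:
  fixes q \<delta> Q :: real
  assumes "0 < q" "q < 1" "0 < \<delta>" "\<delta> < 1" "1 \<le> Q"
  obtains C where "0 < C" and "\<And>\<epsilon>. 0 < \<epsilon> \<Longrightarrow> \<epsilon> \<le> \<delta> \<Longrightarrow>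
    \<exists>m>0. q ^ m \<le> (\<epsilon> / 2)\<^sup>2 \<and> \<epsilon> powr C \<le> 1 / (2 * Q ^ m)"
proof
  define L where "L = - ln \<delta>"
  define \<beta> where "\<beta> = (2 + 2 * ln 2 / L) / (- ln q)"
  \<comment> \<open>The first \<open>ln 2 / L\<close> pays for the factor 2, \<open>\<beta>\<close>
    for the size of \<open>m\<close>, and \<open>1 / L\<close> for rounding \<open>m\<close>
    up.\<close>
  define C where "C = ln 2 / L + (\<beta> + 1 / L) * ln Q"
  have L: "0 < L"
    using assms by (simp add: L_def)
  have \<beta>: "0 < \<beta>"
    using assms L by (simp add: \<beta>_def divide_pos_neg add_pos_pos)
  show "0 < C"
    using assms L \<beta> by (auto simp: C_def intro!: add_pos_nonneg)
  fix \<epsilon> :: real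
  assume \<epsilon>: "0 < \<epsilon>" "\<epsilon> \<le> \<delta>"
  define t where "t = - ln \<epsilon>"
  define m where "m = nat \<lceil>\<beta> * t\<rceil>"
  have t: "L \<le> t"
    using \<epsilon> assms by (simp add: t_def L_def)
  then have t0: "0 < t" and tL: "1 \<le> t / L"
    using L by auto
  have \<beta>t: "0 < \<beta> * t"
    using \<beta> t0 by simp
  then have m: "0 < m" "\<beta> * t \<le> real m" "real m \<le> \<beta> * t + 1"
    unfolding m_def by linarith+
  have "2 * t + 2 * ln 2 \<le> 2 * t + 2 * ln 2 * (t / L)"
    using mult_left_mono [OF tL, of "2 * ln 2"] by simp
  also have "\<dots> = \<beta> * t * (- ln q)"
  proof -
    have "\<beta> * (- ln q) = 2 + 2 * ln 2 / L"
      using assms by (simp add: \<beta>_def)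
    then show ?thesis
      by (simp only: mult.assoc mult.left_commute [of \<beta>]) (simp add: algebra_simps)
  qed
  also have "\<dots> \<le> real m * (- ln q)"
    using m(2) assms by (intro mult_right_mono) auto
  finally have "real m * ln q \<le> 2 * ln (\<epsilon> / 2)"
    using \<epsilon> by (simp add: t_def ln_div)
  then have "ln (q ^ m) \<le> ln ((\<epsilon> / 2)\<^sup>2)"
    using assms \<epsilon> by (simp add: ln_realpow)
  then have 1: "q ^ m \<le> (\<epsilon> / 2)\<^sup>2"
    using assms \<epsilon> by simp
  have "ln 2 + real m * ln Q \<le> ln 2 * (t / L) + (\<beta> * t + t / L) * ln Q"
    using mult_left_mono [OF tL, of "ln 2"] tL m(3) assms
    by (intro add_mono mult_right_mono) auto
  also have "\<dots> = C * t"
    by (simp add: C_def algebra_simps)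
  finally have "ln (2 * Q ^ m) \<le> C * t"
    using assms by (simp add: ln_mult ln_realpow)
  then have "2 * Q ^ m \<le> exp (C * t)"
    using assms by (simp add: ln_ge_iff [symmetric] flip: ln_le_cancel_iff)
  then have "\<epsilon> powr C \<le> 1 / (2 * Q ^ m)"
    using \<epsilon> assms by (simp add: powr_def t_def exp_minus field_simps)
  with 1 m(1) show "\<exists>m>0. q ^ m \<le> (\<epsilon> / 2)\<^sup>2 \<and> \<epsilon> powr C \<le> 1 / (2 * Q ^ m)"
    by blast
qed

theorem theorem4p4:
  fixes k :: nat and c :: "nat \<Rightarrow> int"
  assumes "k \<ge> 3"
    and "\<And>i. i \<in> {1..k} \<Longrightarrow> c i \<noteq> 0"
    and "(\<Sum>i=1..k. c i) \<noteq> 0"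
  shows "\<forall>\<delta>::real. 0 < \<delta> \<and> \<delta> < 1 \<longrightarrow>
           (\<exists>C::real. C > 0 \<and>
             (\<forall>\<epsilon>::real. 0 < \<epsilon> \<and> \<epsilon> \<le> \<delta> \<longrightarrow>
               ereal (\<epsilon> powr C) \<le> solution_free_density k c \<epsilon>))"
proof (intro allI impI)
  fix \<delta> :: real
  assume \<delta>: "0 < \<delta> \<and> \<delta> < 1"
  define l where "l = (\<Sum>i=1..k. \<bar>c i\<bar>) + 1"
  define M where "M = (\<bar>\<Sum>i=1..k. c i\<bar> + 1) * l"
  define a where "a = 1 + 1 / real k"
  \<comment> \<open>\<open>q\<close> is the net factor per unit of distance: cost of
    \<open>k\<close> coordinates over gain \<open>a\<close>. Thus
    \<open>q ^ m \<le> (\<epsilon> / 2)^2\<close> is the smallness condition of the concentration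
    step.\<close>
  define q where "q = ((1 + a)\<^sup>2 / (4 * a)) ^ k / a"
  have l: "0 < l"
    unfolding l_def by (smt (verit) sum_nonneg abs_ge_zero)
  then have lM: "l < M"
    using assms(3) by (simp add: M_def)
  have a: "1 < a"
    using assms(1) by (simp add: a_def)
  then have "0 < a"
    by simp
  have q: "0 < q" "q < 1"
  proof -
    have "((1 + a)\<^sup>2 / (4 * a)) ^ k < a"
      using assms(1) a_def by (intro talagrand_constant_power_less) auto
    then show "0 < q" "q < 1"
      using a by (simp_all add: q_def)
  qed
  have "1 \<le> real_of_int M ^ k"
    using l lM by (intro one_le_power) simp
  with q \<delta> obtain C where C: "0 < C" and ex: "\<And>\<epsilon>. 0 < \<epsilon> \<Longrightarrow> \<epsilon> \<le> \<delta> \<Longrightarrow>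
      \<exists>m>0. q ^ m \<le> (\<epsilon> / 2)\<^sup>2 \<and> \<epsilon> powr C \<le> 1 / (2 * (real_of_int M ^ k) ^ m)"
    using exists_power_exponent by blast
  have "ereal (\<epsilon> powr C) \<le> solution_free_density k c \<epsilon>" if \<epsilon>: "0 < \<epsilon>" "\<epsilon> \<le> \<delta>" for \<epsilon>
  proof -
    obtain m where m: "0 < m" "q ^ m \<le> (\<epsilon> / 2)\<^sup>2" "\<epsilon> powr C \<le> 1 / (2 * (real_of_int M ^ k) ^ m)"
      using ex \<epsilon> by blast
    define Q where "Q = M ^ (k * m)"
    have Q: "0 < Q"
      using l lM by (simp add: Q_def)
    have small: "(((1 + a)\<^sup>2 / (4 * a)) ^ k) ^ m \<le> (\<epsilon> / 2)\<^sup>2 * a ^ m"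
      using m(2) \<open>0 < a\<close> by (simp only: q_def power_divide [of _ a] pos_divide_le_eq zero_less_power)
    show ?thesis
    proof (rule solution_free_density_ge)
      fix p
      define A where "A = mostly_near (int p) M l k (k * m)"
      \<comment> \<open>This threshold gives both \<open>Q \<le> p\<close> and
        \<open>p / Q - 1 \<ge> p / (2 * Q)\<close>.\<close>
      assume "nat (2 * Q) \<le> p"
      then have p2: "2 * Q \<le> int p"
        by simp
      then have p0: "0 < p"
        using Q by simp
      have "\<epsilon> powr C * real p \<le> 1 / (2 * real_of_int Q) * real p"
        using m(3) by (intro mult_right_mono) (simp_all add: Q_def power_mult)
      also have "\<dots> \<le> real p / real_of_int Q - 1"
        using Q p2 by (simp add: field_simps)
      also have "\<dots> \<le> real (card A)"
        using card_mostly_near [of "int p" l M "k * m" k] l lM p0 m(1) assms(1)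
        by (simp add: A_def Q_def)
      also have "card A \<le> max_solution_free k c \<epsilon> p"
      proof (rule max_solution_free_ge)
        show "solution_free k c p A"
          unfolding A_def using p0 assms(3) l_def M_def by (rule solution_free_mostly_near)
        show "real (independence_number (with_proj (cayley_digraph p A))) \<le> \<epsilon> * real p"
          unfolding A_def using assms(1) p2 Q
          by (intro independence_number_mostly_near [OF p0 l lM _ m(1) a \<epsilon>(1) _ small])
            (simp_all add: Q_def)
      qed
      finally show "\<epsilon> powr C * real p \<le> real (max_solution_free k c \<epsilon> p)"
        by simp
    qed
  qed
  with C show "\<exists>C>0. \<forall>\<epsilon>. 0 < \<epsilon> \<and> \<epsilon> \<le> \<delta> \<longrightarrow> ereal (\<epsilon> powr C) \<le> solution_free_density k c \<epsilon>"
    by blast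
qed

end
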